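(* Let $X=(x_1,\dots,x_n)$ be a set of $n$ inputs, let $J_X\in\mathbb{R}^{nC\times p}$ be the concatenated Jacobian of the model at $\hat\theta$, let $\Psi\in\mathbb{R}^{p\times p}$ be the (symmetric positive definite) Laplace posterior covariance, and let $\Sigma_X=J_X\Psi J_X^\top\in\mathbb{R}^{nC\times nC}$. Let $\Sigma_X=U\Lambda U^\top$ be an eigendecomposition with $U$ orthogonal and $\Lambda=\mathrm{diag}(\sigma_1,\dots,\sigma_{nC})$, $\sigma_1\ge\sigma_2\ge\dots\ge\sigma_{nC}\ge 0$. Let $1\le s\le\min(nC,p)$, let $U_s\in\mathbb{R}^{nC\times s}$ consist of the first $s$ columns of $U$, and let $\Lambda_s=\mathrm{diag}(\sigma_1,\dots,\sigma_s)$. For $P\in\mathbb{R}^{p\times s}$ with $\operatorname{rank}P=s$ put $$\Sigma_{P,X}=J_XP\,(P^\top\Psi^{-1}P)^{-1}P^\top J_X^\top\in\mathbb{R}^{nC\times nC},$$ and consider the minimization problem $$\min_{P\in\mathbb{R}^{p\times s},\ \operatorname{rank}P=s}\ \|\Sigma_{P,X}-\Sigma_X\|_F ,\qquad(\ast)$$ where $\|\cdot\|_F$ is the Frobenius norm. Suppose that $J_X$ has full rank, i.e. $\operatorname{rank}J_X=\min(nC,p)$. Then: (1) For every invertible $Q\in\mathbb{R}^{s\times s}$ the matrix $$P^*=\Psi J_X^\top U_sQ$$ is a solution of $(\ast)$ (in particular it has rank $s$), and for every such $P^*$ one has $\Sigma_{P^*,X}=U_s\Lambda_sU_s^\top$.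 (2) If $\sigma_s>\sigma_{s+1}$ (with the convention $\sigma_{nC+1}=0$), then the solution of $(\ast)$ is unique up to reparametrization: every minimizer of $(\ast)$ is of the form $\Psi J_X^\top U_sQ$ for some invertible $Q\in\mathbb{R}^{s\times s}$.
   Context: Setting: $f_\theta$ is a parametric model (neural network) with parameter $\theta\in\mathbb{R}^p$ and output $f_\theta(x)\in\mathbb{R}^C$, differentiable in $\theta$ at a fixed parameter $\hat\theta\in\mathbb{R}^p$ (the maximum a posteriori estimate). For inputs $X=(x_1,\dots,x_n)$, $J_X\in\mathbb{R}^{nC\times p}$ is the vertical concatenation of the Jacobians $\nabla_\theta f_\theta(x_i)|_{\theta=\hat\theta}\in\mathbb{R}^{C\times p}$, $i=1,\dots,n$. The Laplace posterior covariance $\Psi\in\mathbb{R}^{p\times p}$ is given by the generalized Gauss-Newton form $$\Psi^{-1}=\sum_{i=1}^N J_{f_i}^\top H_i J_{f_i}+\lambda\,\mathbb{1}_p,$$ where $J_{f_i}\in\mathbb{R}^{C\times p}$ is the Jacobian of $\theta\mapsto f_\theta(x_i^{\mathrm{train}})$ at $\hat\theta$ for the $i$-th of $N$ training inputs, $H_i\in\mathbb{R}^{C\times C}$ is the symmetric positive semi-definite Hessian of the negative log-likelihood with respect to the model output, and $\lambda>0$ is the prior precision. In particular $\Psi$ is symmetric positive definite. *)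

theory Defs
  imports "HOL-Analysis.Analysis"
begin

definition frobenius_norm :: "real^'n^'m \<Rightarrow> real" where
  "frobenius_norm A = sqrt (\<Sum>i\<in>UNIV. \<Sum>j\<in>UNIV. (A $ i $ j)\<^sup>2)"

definition symmetric_matrix :: "real^'n^'n \<Rightarrow> bool" where
  "symmetric_matrix A \<longleftrightarrow> transpose A = A"

definition pos_semidef :: "real^'n^'n \<Rightarrow> bool" where
  "pos_semidef A \<longleftrightarrow> (\<forall>v. 0 \<le> v \<bullet> (A *v v))"

definition has_hessian :: "(real^'n \<Rightarrow> real) \<Rightarrow> real^'n^'n \<Rightarrow> real^'n \<Rightarrow> bool" where
  "has_hessian l H u \<longleftrightarrow>
     (\<exists>g. (\<forall>\<^sub>F v in nhds u. (l has_derivative (\<lambda>h. g v \<bullet> h)) (at v)) \<and>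
          (g has_derivative (\<lambda>h. H *v h)) (at u))"

text \<open>Finite index types carry no order, so a numbering of the indices by \<open>1, 2, \<dots>\<close> is made
  explicit wherever ``the first columns'' or ``decreasing eigenvalues'' are meant.\<close>

definition numbering :: "('a::finite \<Rightarrow> nat) \<Rightarrow> bool" where
  "numbering \<nu> \<longleftrightarrow> bij_betw \<nu> UNIV {1..CARD('a)}"

definition diag_matrix :: "('a::finite \<Rightarrow> nat) \<Rightarrow> (nat \<Rightarrow> real) \<Rightarrow> real^'a^'a" where
  "diag_matrix \<nu> \<sigma> = (\<chi> i j. if i = j then \<sigma> (\<nu> i) else 0)"

text \<open>The column of the result that has number \<open>k\<close> under \<open>\<kappa>\<close> is the column of \<open>U\<close> that has
  number \<open>k\<close> under \<open>\<nu>\<close>.\<close>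

definition first_columns ::
    "('m::finite \<Rightarrow> nat) \<Rightarrow> ('s::finite \<Rightarrow> nat) \<Rightarrow> real^'m^'m \<Rightarrow> real^'s^'m" where
  "first_columns \<nu> \<kappa> U = (\<chi> i j. U $ i $ (inv \<nu> (\<kappa> j)))"

definition param_jacobian ::
    "(real^'p \<Rightarrow> 'x \<Rightarrow> real^'c) \<Rightarrow> real^'p \<Rightarrow> 'x \<Rightarrow> real^'p^'c" where
  "param_jacobian f \<theta> z = jacobian (\<lambda>t. f t z) (at \<theta>)"

text \<open>Row \<open>(i, c)\<close> is row \<open>c\<close> of the \<open>i\<close>-th vertically stacked block.\<close>

definition concat_jacobian ::
    "(real^'p \<Rightarrow> 'x \<Rightarrow> real^'c) \<Rightarrow> real^'p \<Rightarrow> ('n::finite \<Rightarrow> 'x) \<Rightarrow> real^'p^('n \<times> 'c)" where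
  "concat_jacobian f \<theta> x = (\<chi> r. param_jacobian f \<theta> (x (fst r)) $ snd r)"

definition ggn_precision ::
    "(real^'p \<Rightarrow> 'x \<Rightarrow> real^'c) \<Rightarrow> real^'p \<Rightarrow> nat \<Rightarrow> (nat \<Rightarrow> 'x) \<Rightarrow> (nat \<Rightarrow> real^'c^'c) \<Rightarrow> real
      \<Rightarrow> real^'p^'p" where
  "ggn_precision f \<theta> N xt H \<tau> =
     (\<Sum>i=1..N. transpose (param_jacobian f \<theta> (xt i)) ** H i ** param_jacobian f \<theta> (xt i))
      + \<tau> *\<^sub>R mat 1"

definition laplace_covariance ::
    "(real^'p \<Rightarrow> 'x \<Rightarrow> real^'c) \<Rightarrow> real^'p \<Rightarrow> nat \<Rightarrow> (nat \<Rightarrow> 'x) \<Rightarrow> (nat \<Rightarrow> real^'c^'c) \<Rightarrow> real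
      \<Rightarrow> real^'p^'p" where
  "laplace_covariance f \<theta> N xt H \<tau> = matrix_inv (ggn_precision f \<theta> N xt H \<tau>)"

definition predictive_cov :: "real^'p^'m \<Rightarrow> real^'p^'p \<Rightarrow> real^'m^'m" where
  "predictive_cov J \<Psi> = J ** \<Psi> ** transpose J"

definition subspace_cov :: "real^'p^'m \<Rightarrow> real^'p^'p \<Rightarrow> real^'s^'p \<Rightarrow> real^'m^'m" where
  "subspace_cov J \<Psi> P =
     J ** P ** matrix_inv (transpose P ** matrix_inv \<Psi> ** P) ** transpose P ** transpose J"

definition is_optimal_subspace :: "real^'p^'m \<Rightarrow> real^'p^'p \<Rightarrow> real^'s^'p \<Rightarrow> bool" where
  "is_optimal_subspace J \<Psi> P \<longleftrightarrow>
     is_arg_min (\<lambda>P :: real^'s^'p. frobenius_norm (subspace_cov J \<Psi> P - predictive_cov J \<Psi>))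
       (\<lambda>P. rank P = CARD('s)) P"

end

theory Submission
  imports Defs
begin

text \<open>Put \<open>A = \<Psi>\<^sup>-\<^sup>1\<close>. Optimality is the Eckart--Young theorem: if the range of \<open>B\<close> lies in a space
  of dimension \<open>s\<close> with orthogonal projection \<open>\<Pi>\<close>, then
  \<open>\<parallel>B - \<Sigma>\<parallel>\<^sup>2 = \<Sum>\<^sub>k \<sigma>\<^sub>k\<^sup>2 (1 - t\<^sub>k) + \<parallel>B u\<^sub>k - \<sigma>\<^sub>k \<Pi> u\<^sub>k\<parallel>\<^sup>2\<close> with weights \<open>t\<^sub>k = \<parallel>\<Pi> u\<^sub>k\<parallel>\<^sup>2\<close> in \<open>[0, 1]\<close> of
  total at most \<open>s\<close>, and this is smallest when the weights sit on the \<open>s\<close> largest eigenvalues.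
  Put \<open>W = \<Psi> J\<^sup>T U\<^sub>s\<close>, so that \<open>W\<^sup>T A = U\<^sub>s\<^sup>T J\<close> and \<open>W\<^sup>T A W = \<Lambda>\<^sub>s\<close>; full rank of \<open>J\<close> makes \<open>\<Lambda>\<^sub>s\<close>
  invertible, whence \<open>\<Sigma>\<^sub>P = U\<^sub>s \<Lambda>\<^sub>s U\<^sub>s\<^sup>T\<close> for \<open>P = W Q\<close>. Conversely, if \<open>\<Sigma>\<^sub>P = U\<^sub>s \<Lambda>\<^sub>s U\<^sub>s\<^sup>T\<close> and
  \<open>K = U\<^sub>s\<^sup>T J P\<close>, \<open>Q = \<Lambda>\<^sub>s\<^sup>-\<^sup>1 K\<close>, then \<open>P\<^sup>T A P\<close>, \<open>P\<^sup>T A W Q\<close> and \<open>(W Q)\<^sup>T A W Q\<close> all equal \<open>K\<^sup>T \<Lambda>\<^sub>s\<^sup>-\<^sup>1 K\<close>,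
  so \<open>(P - W Q)\<^sup>T A (P - W Q) = 0\<close> and \<open>P = W Q\<close>.\<close>

section \<open>Matrix algebra: adjoints, inverses and transposes\<close>

lemma inner_matrix_vector_left:
  fixes A :: "real^'n^'m"
  shows "(A *v x) \<bullet> y = x \<bullet> (transpose A *v y)"
  by (metis dot_lmul_matrix inner_commute transpose_matrix_vector)

lemma
  fixes A :: "real^'n^'n"
  assumes "invertible A"
  shows matrix_inv_left: "matrix_inv A ** A = mat 1"
    and matrix_inv_right: "A ** matrix_inv A = mat 1"
proof -
  have "\<exists>B. A ** B = mat 1 \<and> B ** A = mat 1"
    using assms by (auto simp: invertible_def)
  from someI_ex[OF this] show "matrix_inv A ** A = mat 1" "A ** matrix_inv A = mat 1"
    by (auto simp: matrix_inv_def)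
qed

lemma matrix_inv_eqI:
  fixes A B :: "real^'n^'n"
  assumes "A ** B = mat 1"
  shows "matrix_inv A = B"
proof -
  have "invertible A"
    using assms invertible_right_inverse by blast
  then show ?thesis
    by (metis assms matrix_inv_left matrix_mul_assoc matrix_mul_lid matrix_mul_rid)
qed

lemma matrix_diff_ldistrib: "A ** (B - C) = A ** B - A ** C"
  for A :: "real^'n^'m"
  by (simp add: vec_eq_iff matrix_matrix_mult_def algebra_simps sum_subtractf)

lemma matrix_diff_rdistrib: "(A - B) ** C = A ** C - B ** C"
  for A :: "real^'n^'m"
  by (simp add: vec_eq_iff matrix_matrix_mult_def algebra_simps sum_subtractf)

lemma transpose_sum: "transpose (\<Sum>i\<in>I. A i) = (\<Sum>i\<in>I. transpose (A i))"
  by (simp add: vec_eq_iff transpose_def)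

lemma transpose_add: "transpose (A + B) = transpose A + transpose B"
  by (simp add: vec_eq_iff transpose_def)

lemma transpose_diff: "transpose (A - B) = transpose A - transpose B"
  for A B :: "real^'n^'m"
  by (simp add: vec_eq_iff transpose_def)

lemma sum_matrix_vector_mult: "(\<Sum>i\<in>I. A i) *v x = (\<Sum>i\<in>I. A i *v x)"
  for A :: "'i \<Rightarrow> real^'n^'m"
  by (induction I rule: infinite_finite_induct) (auto simp: matrix_vector_mult_add_rdistrib)

section \<open>Positive definite matrices and the Gauss-Newton precision\<close>

definition pos_def :: "real^'n^'n \<Rightarrow> bool" where
  "pos_def A \<longleftrightarrow> (\<forall>v. v \<noteq> 0 \<longrightarrow> 0 < v \<bullet> (A *v v))"

lemma pos_def_invertible:
  assumes "pos_def A"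
  shows "invertible A"
  using assms unfolding pos_def_def invertible_left_inverse matrix_left_invertible_ker
  by (metis inner_zero_right less_irrefl)

lemma inner_congruence:
  fixes A :: "real^'p^'p" and P :: "real^'s^'p"
  shows "v \<bullet> ((transpose P ** A ** P) *v v) = (P *v v) \<bullet> (A *v (P *v v))"
  by (simp add: inner_matrix_vector_left matrix_vector_mul_assoc matrix_mul_assoc
      del: transpose_matrix_vector)

lemma pos_def_congruence:
  fixes A :: "real^'p^'p" and P :: "real^'s^'p"
  assumes "pos_def A" and "rank P = CARD('s)"
  shows "pos_def (transpose P ** A ** P)"
  unfolding pos_def_def
proof (intro allI impI)
  fix v :: "real^'s" assume "v \<noteq> 0"
  moreover have "inj ((*v) P)"
    using assms(2) full_rank_injective by blast
  ultimately have "P *v v \<noteq> 0"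
    by (metis injD matrix_vector_mult_0_right)
  then show "0 < v \<bullet> ((transpose P ** A ** P) *v v)"
    using assms(1) by (simp add: inner_congruence pos_def_def)
qed

text \<open>The form of \<open>A\<close> at \<open>E *v v\<close> is zero for every
  \<open>v\<close>, so \<open>E\<close> kills every vector. With \<open>E\<close> a difference of
  two matrices this turns equality of Gram products into equality of the matrices.\<close>

lemma pos_def_congruence_eq_0:
  fixes A :: "real^'p^'p" and E :: "real^'s^'p"
  assumes "pos_def A" and "transpose E ** A ** E = 0"
  shows "E = 0"
proof -
  have "E *v v = 0" for v
    using inner_congruence[of v E A] assms by (auto simp: pos_def_def)
  then show ?thesis
    by (simp add: matrix_eq)
qed

lemma pos_def_matrix_inv:
  fixes A :: "real^'n^'n"
  assumes "pos_def A"
  shows "pos_def (matrix_inv A)"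
  unfolding pos_def_def
proof (intro allI impI)
  fix v :: "real^'n" assume v: "v \<noteq> 0"
  have *: "A *v (matrix_inv A *v v) = v"
    by (simp add: matrix_vector_mul_assoc matrix_inv_right pos_def_invertible assms)
  with v have "matrix_inv A *v v \<noteq> 0"
    by auto
  then show "0 < v \<bullet> (matrix_inv A *v v)"
    using assms * by (metis inner_commute pos_def_def)
qed

lemma transpose_matrix_inv:
  fixes A :: "real^'n^'n"
  assumes "invertible A" and "transpose A = A"
  shows "transpose (matrix_inv A) = matrix_inv A"
  by (metis assms matrix_inv_eqI matrix_inv_left matrix_transpose_mul transpose_mat)

text \<open>Each Gauss-Newton term is a congruence of a positive semidefinite \<open>H i\<close>,
  hence has a nonnegative form; the prior adds \<open>\<tau>\<close> times the squared norm, which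
  makes the total strictly positive.\<close>

lemma ggn_precision_pos_def:
  fixes f :: "real^'p \<Rightarrow> 'x \<Rightarrow> real^'c"
  assumes "\<And>i. i \<in> {1..N} \<Longrightarrow> pos_semidef (H i)" and "\<tau> > 0"
  shows "pos_def (ggn_precision f \<theta> N xt H \<tau>)"
  unfolding pos_def_def
proof (intro allI impI)
  fix v :: "real^'p" assume v: "v \<noteq> 0"
  let ?G = "\<lambda>i. transpose (param_jacobian f \<theta> (xt i)) ** H i ** param_jacobian f \<theta> (xt i)"
  have "v \<bullet> (ggn_precision f \<theta> N xt H \<tau> *v v) = (\<Sum>i=1..N. v \<bullet> (?G i *v v)) + \<tau> * (v \<bullet> v)"
    by (simp add: ggn_precision_def matrix_vector_mult_add_rdistrib sum_matrix_vector_mult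
        inner_right_distrib inner_sum_right flip: scaleR_matrix_vector_assoc)
  moreover have "0 \<le> (\<Sum>i=1..N. v \<bullet> (?G i *v v))"
    using assms(1) by (intro sum_nonneg) (simp add: inner_congruence pos_semidef_def)
  ultimately show "0 < v \<bullet> (ggn_precision f \<theta> N xt H \<tau> *v v)"
    using v assms(2) by (simp add: add_nonneg_pos)
qed

lemma ggn_precision_symmetric:
  assumes "\<And>i. i \<in> {1..N} \<Longrightarrow> symmetric_matrix (H i)"
  shows "transpose (ggn_precision f \<theta> N xt H \<tau>) = ggn_precision f \<theta> N xt H \<tau>"
  using assms
  by (simp add: ggn_precision_def transpose_add transpose_sum matrix_transpose_mul
      transpose_scalar matrix_mul_assoc symmetric_matrix_def)

section \<open>Diagonal matrices, orthonormal columns and the Frobenius norm\<close>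

lemma diag_mult:
  fixes a b :: "'n::finite \<Rightarrow> real"
  shows "(\<chi> i j. if i = j then a i else 0) ** (\<chi> i j. if i = j then b i else 0)
    = (\<chi> i j. if i = j then a i * b i else 0)"
proof -
  have *: "(if i = k then a i else 0) * (if k = j then b k else 0)
      = (if k = i then (if i = j then a i * b i else 0) else 0)" for i j k
    by simp
  show ?thesis
    by (simp only: vec_eq_iff matrix_matrix_mult_def vec_lambda_beta *) simp
qed

lemma frobenius_norm_nonneg: "0 \<le> frobenius_norm A"
  by (simp add: frobenius_norm_def sum_nonneg)

lemma inner_column_orthogonal:
  fixes U :: "real^'m^'m"
  assumes "orthogonal_matrix U"
  shows "column i U \<bullet> column j U = (if i = j then 1 else 0)"
proof -
  have "(transpose U ** U) $ i $ j = (mat 1 :: real^'m^'m) $ i $ j"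
    using assms by (simp add: orthogonal_matrix)
  then show ?thesis
    by (simp add: matrix_mult_transpose_dot_column mat_def)
qed

lemma norm_column_orthogonal: "orthogonal_matrix U \<Longrightarrow> norm (column i U) = 1"
  for U :: "real^'m^'m"
  by (simp add: norm_eq_1 inner_column_orthogonal)

text \<open>Parseval's identity: the inner products are the entries of
  \<open>transpose U *v x\<close>, and \<open>transpose U\<close> preserves the norm.\<close>

lemma sum_inner_column_squared:
  fixes U :: "real^'m^'m"
  assumes "orthogonal_matrix U"
  shows "(\<Sum>k\<in>UNIV. (x \<bullet> column k U)\<^sup>2) = x \<bullet> x"
proof -
  have "(\<Sum>k\<in>UNIV. (x \<bullet> column k U)\<^sup>2) = (transpose U *v x) \<bullet> (transpose U *v x)"
    by (simp add: inner_vec_def[of "transpose U *v x"] matrix_vector_mul_component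
        inner_commute power2_eq_square column_def del: transpose_matrix_vector)
      (simp add: transpose_def inner_vec_def)
  also have "\<dots> = x \<bullet> x"
    using assms by (simp add: inner_matrix_vector_left matrix_vector_mul_assoc
        orthogonal_matrix_def del: transpose_matrix_vector)
  finally show ?thesis .
qed

text \<open>Parseval applied to every row of \<open>D\<close>, followed by exchanging the two sums.
  It allows errors to be measured in an eigenbasis.\<close>

lemma frobenius_norm_squared_orthogonal:
  fixes D :: "real^'m^'k"
  assumes "orthogonal_matrix U"
  shows "(frobenius_norm D)\<^sup>2 = (\<Sum>k\<in>UNIV. (norm (D *v column k U))\<^sup>2)"
proof -
  have "(frobenius_norm D)\<^sup>2 = (\<Sum>i\<in>UNIV. D $ i \<bullet> D $ i)"
    by (simp add: frobenius_norm_def sum_nonneg inner_vec_def power2_eq_square)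
  also have "\<dots> = (\<Sum>i\<in>UNIV. \<Sum>k\<in>UNIV. (D $ i \<bullet> column k U)\<^sup>2)"
    by (simp add: sum_inner_column_squared[OF assms])
  also have "\<dots> = (\<Sum>k\<in>UNIV. \<Sum>i\<in>UNIV. (D $ i \<bullet> column k U)\<^sup>2)"
    by (rule sum.swap)
  also have "\<dots> = (\<Sum>k\<in>UNIV. (norm (D *v column k U))\<^sup>2)"
    unfolding dot_square_norm[symmetric]
    by (simp add: inner_vec_def[of "D *v _"] matrix_vector_mul_component power2_eq_square)
  finally show ?thesis .
qed

lemma matrix_eq_on_orthogonal_columns:
  fixes M N :: "real^'m^'k"
  assumes "orthogonal_matrix U" and "\<And>r. M *v column r U = N *v column r U"
  shows "M = N"
proof -
  have "M ** U = N ** U"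
    using assms(2)
    by (simp add: vec_eq_iff matrix_vector_mult_def column_def matrix_matrix_mult_def)
  then have "M ** U ** transpose U = N ** U ** transpose U"
    by simp
  then show ?thesis
    using assms(1) by (simp add: orthogonal_matrix_def flip: matrix_mul_assoc)
qed

section \<open>The Eckart-Young theorem with uniqueness\<close>

text \<open>The bound on the total weight says that the weight outside \<open>T\<close> is at most
  the weight missing inside \<open>T\<close>. Outside \<open>T\<close> a unit of weight saves at
  most the square of \<open>c\<close>, inside \<open>T\<close> a missing unit costs at least that
  much. With a strict gap any missing weight inside \<open>T\<close> costs more than can be saved,
  so equality forces weight 1 on \<open>T\<close> and hence 0 elsewhere.\<close>

lemma weighted_squares_lower_bound:
  fixes t d :: "'m::finite \<Rightarrow> real"
  assumes t: "\<And>r. 0 \<le> t r" "\<And>r. t r \<le> 1" and sum_t: "sum t UNIV \<le> card T"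
    and c: "0 \<le> c" "\<And>r. r \<in> T \<Longrightarrow> c \<le> d r" "\<And>r. r \<notin> T \<Longrightarrow> 0 \<le> d r \<and> d r \<le> c"
  shows "(\<Sum>r\<in>-T. (d r)\<^sup>2) \<le> (\<Sum>r\<in>UNIV. (d r)\<^sup>2 * (1 - t r))" (is ?le)
    and "\<lbrakk>\<And>r. r \<in> T \<Longrightarrow> c < d r; (\<Sum>r\<in>UNIV. (d r)\<^sup>2 * (1 - t r)) \<le> (\<Sum>r\<in>-T. (d r)\<^sup>2)\<rbrakk>
           \<Longrightarrow> t r = (if r \<in> T then 1 else 0)"
proof -
  have split: "sum g UNIV = sum g T + sum g (-T)" for g :: "'m \<Rightarrow> real"
    by (metis Compl_disjoint Compl_partition finite sum.union_disjoint)
  have out_t: "sum t (-T) \<le> (\<Sum>r\<in>T. 1 - t r)"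
    using sum_t split[of t] by (simp add: sum_subtractf)
  have "(\<Sum>r\<in>-T. (d r)\<^sup>2 * t r) \<le> (\<Sum>r\<in>-T. c\<^sup>2 * t r)"
    using c t by (intro sum_mono mult_right_mono power_mono) auto
  also have "\<dots> \<le> c\<^sup>2 * (\<Sum>r\<in>T. 1 - t r)"
    unfolding sum_distrib_left[symmetric] by (rule mult_left_mono[OF out_t]) simp
  finally have out: "(\<Sum>r\<in>-T. (d r)\<^sup>2 * t r) \<le> (\<Sum>r\<in>T. c\<^sup>2 * (1 - t r))"
    by (simp add: sum_distrib_left)
  \<comment> \<open>The excess over the claimed bound is split by adding and subtracting the square
    of \<open>c\<close> on \<open>T\<close>; both parts are nonnegative.\<close>
  have eq: "(\<Sum>r\<in>UNIV. (d r)\<^sup>2 * (1 - t r)) - (\<Sum>r\<in>-T. (d r)\<^sup>2)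
      = (\<Sum>r\<in>T. ((d r)\<^sup>2 - c\<^sup>2) * (1 - t r))
        + ((\<Sum>r\<in>T. c\<^sup>2 * (1 - t r)) - (\<Sum>r\<in>-T. (d r)\<^sup>2 * t r))"
    unfolding split[of "\<lambda>r. (d r)\<^sup>2 * (1 - t r)"]
    by (simp add: sum_subtractf algebra_simps sum.distrib)
  have ge: "0 \<le> ((d r)\<^sup>2 - c\<^sup>2) * (1 - t r)" if "r \<in> T" for r
    using that c t by (intro mult_nonneg_nonneg) (auto intro!: power_mono)
  then have sum_ge: "0 \<le> (\<Sum>r\<in>T. ((d r)\<^sup>2 - c\<^sup>2) * (1 - t r))"
    by (rule sum_nonneg)
  show ?le
    using eq out sum_ge by linarith
  assume strict: "\<And>r. r \<in> T \<Longrightarrow> c < d r"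
    and le: "(\<Sum>r\<in>UNIV. (d r)\<^sup>2 * (1 - t r)) \<le> (\<Sum>r\<in>-T. (d r)\<^sup>2)"
  have "(\<Sum>r\<in>T. ((d r)\<^sup>2 - c\<^sup>2) * (1 - t r)) = 0"
    using eq out sum_ge le by linarith
  then have zero: "((d r)\<^sup>2 - c\<^sup>2) * (1 - t r) = 0" if "r \<in> T" for r
    using ge that by (subst (asm) sum_nonneg_eq_0_iff) auto
  have one: "t r = 1" if "r \<in> T" for r
  proof -
    have "c\<^sup>2 < (d r)\<^sup>2"
      using strict[OF that] c(1) by (intro power_strict_mono) auto
    then show ?thesis
      using zero[OF that] by simp
  qed
  have "sum t (-T) = 0"
    using out_t one t by (intro antisym sum_nonneg) auto
  then have "t r = 0" if "r \<notin> T" for r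
    using that t by (subst (asm) sum_nonneg_eq_0_iff) auto
  then show "t r = (if r \<in> T then 1 else 0)"
    using one by simp
qed

text \<open>Here \<open>\<pi>\<close> is the orthogonal projection onto \<open>span B\<close>. The
  last identity is Pythagoras for \<open>w - a u = (w - a \<pi> u) - a (u - \<pi> u)\<close>, whose
  first part lies in the span and whose second part is perpendicular to it.\<close>

lemma orthonormal_projection:
  fixes B :: "'a::euclidean_space set"
  assumes orth: "pairwise orthogonal B" and unit: "\<And>b. b \<in> B \<Longrightarrow> norm b = 1"
    and w: "w \<in> span B"
  defines "\<pi> \<equiv> \<lambda>u. \<Sum>b\<in>B. (b \<bullet> u) *\<^sub>R b"
  shows "norm (\<pi> u) ^ 2 = (\<Sum>b\<in>B. (b \<bullet> u)\<^sup>2)"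
    and "norm (u - \<pi> u) ^ 2 = norm u ^ 2 - (\<Sum>b\<in>B. (b \<bullet> u)\<^sup>2)"
    and "norm (w - a *\<^sub>R u) ^ 2
         = a\<^sup>2 * (norm u ^ 2 - (\<Sum>b\<in>B. (b \<bullet> u)\<^sup>2)) + norm (w - a *\<^sub>R \<pi> u) ^ 2"
proof -
  have unit': "b \<bullet> b = 1" if "b \<in> B" for b
    using unit[OF that] by (simp add: norm_eq_1)
  have perp: "y \<bullet> (u - \<pi> u) = 0" if "y \<in> span B" for y
    using Gram_Schmidt_step[OF orth that, of u] unit' by (simp add: orthogonal_def \<pi>_def)
  have mem: "\<pi> u \<in> span B"
    unfolding \<pi>_def by (intro span_sum span_scale span_base)
  have "\<pi> u \<bullet> \<pi> u = \<pi> u \<bullet> u"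
    using perp[OF mem] by (simp add: inner_diff_right)
  also have "\<dots> = (\<Sum>b\<in>B. (b \<bullet> u)\<^sup>2)"
    by (simp add: \<pi>_def inner_sum_left power2_eq_square)
  finally show 1: "norm (\<pi> u) ^ 2 = (\<Sum>b\<in>B. (b \<bullet> u)\<^sup>2)"
    by (simp add: power2_norm_eq_inner)
  have "norm u ^ 2 = norm (\<pi> u) ^ 2 + norm (u - \<pi> u) ^ 2"
    using norm_add_Pythagorean[of "\<pi> u" "u - \<pi> u"] perp[OF mem] by (simp add: orthogonal_def)
  then show 2: "norm (u - \<pi> u) ^ 2 = norm u ^ 2 - (\<Sum>b\<in>B. (b \<bullet> u)\<^sup>2)"
    using 1 by simp
  have "w - a *\<^sub>R \<pi> u \<in> span B"
    using w mem by (intro span_diff span_scale)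
  then have "orthogonal (w - a *\<^sub>R \<pi> u) (- a *\<^sub>R (u - \<pi> u))"
    using perp by (simp add: orthogonal_def)
  from norm_add_Pythagorean[OF this]
  have "norm (w - a *\<^sub>R u) ^ 2 = norm (w - a *\<^sub>R \<pi> u) ^ 2 + norm (- a *\<^sub>R (u - \<pi> u)) ^ 2"
    by (simp add: algebra_simps)
  then show "norm (w - a *\<^sub>R u) ^ 2
         = a\<^sup>2 * (norm u ^ 2 - (\<Sum>b\<in>B. (b \<bullet> u)\<^sup>2)) + norm (w - a *\<^sub>R \<pi> u) ^ 2"
    by (simp add: 2[symmetric] power_mult_distrib)
qed

lemma eckart_young:
  fixes S B U :: "real^'m^'m" and d :: "'m \<Rightarrow> real"
  assumes orth: "orthogonal_matrix U"
    and eig: "\<And>r. S *v column r U = d r *\<^sub>R column r U"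
    and rank: "rank B \<le> card T"
    and c: "0 \<le> c" "\<And>r. r \<in> T \<Longrightarrow> c \<le> d r" "\<And>r. r \<notin> T \<Longrightarrow> 0 \<le> d r \<and> d r \<le> c"
  shows eckart_young_le: "(\<Sum>r\<in>-T. (d r)\<^sup>2) \<le> (frobenius_norm (B - S))\<^sup>2" (is ?le)
    and eckart_young_unique: "\<lbrakk>\<And>r. r \<in> T \<Longrightarrow> c < d r;
           (frobenius_norm (B - S))\<^sup>2 \<le> (\<Sum>r\<in>-T. (d r)\<^sup>2)\<rbrakk>
           \<Longrightarrow> B *v column r U = (if r \<in> T then d r else 0) *\<^sub>R column r U"
proof -
  have "subspace (range ((*v) B))"
    by (simp add: linear_subspace_image)
  then obtain E where E: "pairwise orthogonal E" "\<And>b. b \<in> E \<Longrightarrow> norm b = 1"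
      "card E = dim (range ((*v) B))" "span E = range ((*v) B)"
    by (rule orthonormal_basis_subspace) auto
  define t where "t r = (\<Sum>b\<in>E. (b \<bullet> column r U)\<^sup>2)" for r
  define \<pi> where "\<pi> u = (\<Sum>b\<in>E. (b \<bullet> u) *\<^sub>R b)" for u
  have mem: "B *v u \<in> span E" for u
    using E(4) by simp
  have norm_pi: "norm (\<pi> (column r U)) ^ 2 = t r" for r
    unfolding t_def \<pi>_def by (rule orthonormal_projection(1)[OF E(1,2) mem])
  have norm_diff: "norm (column r U - \<pi> (column r U)) ^ 2 = 1 - t r" for r
    using orthonormal_projection(2)[OF E(1,2) mem, of "column r U"]
    unfolding t_def \<pi>_def by (simp add: norm_column_orthogonal[OF orth])
  have t01: "0 \<le> t r" "t r \<le> 1" for r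
    using norm_pi[of r] norm_diff[of r] by (metis zero_le_power2, metis diff_ge_0_iff_ge zero_le_power2)
  \<comment> \<open>Exchanging the sums and using Parseval for each unit vector of \<open>E\<close>
    gives total weight \<open>card E\<close>, the rank of \<open>B\<close>.\<close>
  have "sum t UNIV = (\<Sum>b\<in>E. \<Sum>r\<in>UNIV. (b \<bullet> column r U)\<^sup>2)"
    unfolding t_def by (rule sum.swap)
  also have "\<dots> = (\<Sum>b\<in>E. 1)"
    using E(2) by (intro sum.cong) (auto simp: sum_inner_column_squared[OF orth] dot_square_norm)
  finally have sum_t: "sum t UNIV \<le> card T"
    using rank E(3) by (simp add: rank_dim_range)
  have frob: "(frobenius_norm (B - S))\<^sup>2 = (\<Sum>r\<in>UNIV. (d r)\<^sup>2 * (1 - t r))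
      + (\<Sum>r\<in>UNIV. norm (B *v column r U - d r *\<^sub>R \<pi> (column r U)) ^ 2)"
    unfolding frobenius_norm_squared_orthogonal[OF orth] sum.distrib[symmetric]
  proof (rule sum.cong[OF refl])
    fix r
    show "(norm ((B - S) *v column r U))\<^sup>2
        = (d r)\<^sup>2 * (1 - t r) + norm (B *v column r U - d r *\<^sub>R \<pi> (column r U)) ^ 2"
      using orthonormal_projection(3)[OF E(1,2) mem, of "column r U" "d r" "column r U"]
      unfolding t_def \<pi>_def matrix_vector_mult_diff_rdistrib eig norm_column_orthogonal[OF orth]
      by simp
  qed
  have rest: "0 \<le> (\<Sum>r\<in>UNIV. norm (B *v column r U - d r *\<^sub>R \<pi> (column r U)) ^ 2)"
    by (simp add: sum_nonneg)
  have weights: "(\<Sum>r\<in>-T. (d r)\<^sup>2) \<le> (\<Sum>r\<in>UNIV. (d r)\<^sup>2 * (1 - t r))"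
    by (rule weighted_squares_lower_bound(1)[OF t01 sum_t c])
  show ?le
    using frob rest weights by linarith
  assume strict: "\<And>r. r \<in> T \<Longrightarrow> c < d r"
    and le: "(frobenius_norm (B - S))\<^sup>2 \<le> (\<Sum>r\<in>-T. (d r)\<^sup>2)"
  have "(\<Sum>r\<in>UNIV. (d r)\<^sup>2 * (1 - t r)) \<le> (\<Sum>r\<in>-T. (d r)\<^sup>2)"
    using frob rest le by linarith
  from weighted_squares_lower_bound(2)[OF t01 sum_t c strict this]
  have t: "t r = (if r \<in> T then 1 else 0)" .
  have "(\<Sum>r\<in>UNIV. norm (B *v column r U - d r *\<^sub>R \<pi> (column r U)) ^ 2) = 0"
    using frob rest le weights by linarith
  then have "B *v column r U = d r *\<^sub>R \<pi> (column r U)"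
    by (simp add: sum_nonneg_eq_0_iff)
  \<comment> \<open>Weight 1 makes the column equal to its projection; weight 0 makes its projection
    vanish.\<close>
  then show "B *v column r U = (if r \<in> T then d r else 0) *\<^sub>R column r U"
    using t norm_pi[of r] norm_diff[of r] by (auto split: if_splits)
qed


section \<open>The rank of the Jacobian and the spectrum of the predictive covariance\<close>

text \<open>In products associated to the right, \<open>A ** B\<close> is no subterm of
  \<open>A ** (B ** Z)\<close>; this form lets the simplifier use a product equation there.\<close>

lemma matrix_mul_assoc_subst: "A ** B = C \<Longrightarrow> A ** (B ** Z) = C ** Z"
  for A :: "real^'n^'m"
  by (simp add: matrix_mul_assoc)

text \<open>If \<open>d r = 0\<close>, the form of \<open>\<Psi>\<close> vanishes at
  \<open>transpose J *v column r U\<close>, so by positive definiteness that vector is zero. Hence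
  only columns with \<open>d r \<noteq> 0\<close> contribute to the rank of
  \<open>transpose J ** U\<close>, and multiplying back by \<open>transpose U\<close> recovers
  \<open>transpose J\<close>.\<close>

lemma rank_le_card_nonzero_eigenvalues:
  fixes J :: "real^'p^'m"
  assumes \<Psi>: "pos_def \<Psi>" and orth: "orthogonal_matrix U"
    and eig: "\<And>r. predictive_cov J \<Psi> *v column r U = d r *\<^sub>R column r U"
  shows "rank J \<le> card {r. d r \<noteq> 0}"
proof -
  have zero: "transpose J *v column r U = 0" if "d r = 0" for r
  proof -
    have "(transpose J *v column r U) \<bullet> (\<Psi> *v (transpose J *v column r U)) = 0"
      using inner_congruence[of "column r U" "transpose J" \<Psi>] eig[of r] that
      by (simp add: predictive_cov_def del: transpose_matrix_vector)
    then show ?thesis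
      using \<Psi> by (metis pos_def_def less_irrefl)
  qed
  have column: "column r (transpose J ** U) = transpose J *v column r U" for r
    by (simp add: vec_eq_iff matrix_vector_mult_def column_def matrix_matrix_mult_def
        del: transpose_matrix_vector)
  have "rank J = rank (transpose J ** U ** transpose U)"
    using orth by (simp add: orthogonal_matrix_def rank_transpose flip: matrix_mul_assoc)
  also have "\<dots> \<le> rank (transpose J ** U)"
    by (rule rank_mul_le_left)
  also have "\<dots> = dim (columns (transpose J ** U))"
    by (rule column_rank_def)
  also have "\<dots> \<le> dim (insert 0 ((\<lambda>r. transpose J *v column r U) ` {r. d r \<noteq> 0}))"
    using zero by (intro dim_subset) (auto simp: columns_def column simp del: transpose_matrix_vector)
  also have "\<dots> \<le> card ((\<lambda>r. transpose J *v column r U) ` {r. d r \<noteq> 0})"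
    by (simp add: dim_insert span_zero dim_le_card' del: transpose_matrix_vector)
  also have "\<dots> \<le> card {r. d r \<noteq> 0}"
    by (rule card_image_le) simp
  finally show ?thesis .
qed

section \<open>Spectral truncation to the dominant eigenvectors\<close>

text \<open>The numbering of eigenvalues is abstracted to an injection \<open>h\<close>, selecting
  the dominant columns, and a threshold \<open>c\<close> separating their eigenvalues from the
  others. Ties at \<open>c\<close> are allowed, since optimality does not require a spectral
  gap.\<close>

locale dominant_eigenvectors =
  fixes J :: "real^'p^'m" and A :: "real^'p^'p" and U :: "real^'m^'m"
    and d :: "'m \<Rightarrow> real" and h :: "'s::finite \<Rightarrow> 'm" and c :: real
  assumes pos: "pos_def A" and sym: "transpose A = A"
    and orth: "orthogonal_matrix U" and inj: "inj h"
    and eig: "\<And>r. predictive_cov J (matrix_inv A) *v column r U = d r *\<^sub>R column r U"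
    and c_nonneg: "0 \<le> c" and c_le: "\<And>r. r \<in> range h \<Longrightarrow> c \<le> d r"
    and le_c: "\<And>r. r \<notin> range h \<Longrightarrow> 0 \<le> d r \<and> d r \<le> c"
begin

abbreviation "\<Psi> \<equiv> matrix_inv A"
abbreviation "\<Sigma> \<equiv> predictive_cov J \<Psi>"

definition Us :: "real^'s^'m" where "Us = (\<chi> i j. U $ i $ h j)"
definition Ls :: "real^'s^'s" where "Ls = (\<chi> i j. if i = j then d (h i) else 0)"
text \<open>A true inverse of \<open>Ls\<close> only once the dominant eigenvalues are nonzero,
  which comes from the rank of \<open>J\<close>.\<close>

definition Li :: "real^'s^'s" where "Li = (\<chi> i j. if i = j then inverse (d (h i)) else 0)"
definition W :: "real^'s^'p" where "W = \<Psi> ** transpose J ** Us"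

lemma inv_Psi: "matrix_inv \<Psi> = A"
  by (simp add: matrix_inv_eqI matrix_inv_left pos pos_def_invertible)

lemma transpose_Psi: "transpose \<Psi> = \<Psi>"
  by (simp add: pos pos_def_invertible sym transpose_matrix_inv)

lemma column_Us: "column j Us = column (h j) U"
  by (simp add: column_def Us_def vec_eq_iff)

lemma Us_gram: "transpose Us ** Us = mat 1"
  using inj by (simp add: vec_eq_iff matrix_mult_transpose_dot_column column_Us mat_def
      inner_column_orthogonal[OF orth] inj_eq)

lemma Ls_axis: "Ls *v axis k 1 = d (h k) *\<^sub>R axis k 1"
  unfolding matrix_vector_mult_basis
  by (auto simp: Ls_def column_def vec_eq_iff axis_def)

lemma Sigma_Us: "\<Sigma> ** Us = Us ** Ls"
proof (rule matrix_eq_on_orthogonal_columns)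
  \<comment> \<open>The columns of the identity are the standard basis, on which both sides are
    compared.\<close>
  show "orthogonal_matrix (mat 1 :: real^'s^'s)"
    by (rule orthogonal_matrix_id)
  fix k :: 's
  have axis: "column k (mat 1) = (axis k 1 :: real^'s)"
    by (auto simp: column_def mat_def axis_def vec_eq_iff)
  have "\<Sigma> *v (Us *v axis k 1) = Us *v (Ls *v axis k 1)"
    by (simp add: Ls_axis matrix_vector_mult_scaleR)
      (simp add: matrix_vector_mult_basis column_Us eig)
  with axis show "\<Sigma> ** Us *v column k (mat 1) = Us ** Ls *v column k (mat 1)"
    by (simp only: matrix_vector_mul_assoc)
qed

text \<open>A dominant column is the image of a basis vector under \<open>Us\<close>, so
  \<open>transpose Us\<close> sends it back; every other column is orthogonal to all columns of
  \<open>Us\<close>.\<close>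

lemma truncation_eigenvector:
  "(Us ** Ls ** transpose Us) *v column r U = (if r \<in> range h then d r else 0) *\<^sub>R column r U"
proof (cases "r \<in> range h")
  case True
  then obtain k where k: "r = h k" by auto
  have "column r U = Us *v axis k 1"
    by (simp add: matrix_vector_mult_basis column_Us k)
  then show ?thesis
    by (simp add: k matrix_vector_mul_assoc matrix_mul_assoc)
      (simp add: Us_gram Ls_axis matrix_vector_mult_scaleR
        flip: matrix_vector_mul_assoc matrix_mul_assoc)
next
  case False
  have "(transpose Us *v column r U) $ j = column j Us \<bullet> column r U" for j
    by (simp add: matrix_vector_mul_component transpose_def column_def
        del: transpose_matrix_vector)
  with False have "transpose Us *v column r U = 0"
    by (auto simp: vec_eq_iff column_Us inner_column_orthogonal[OF orth]
        simp del: transpose_matrix_vector)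
  with False show ?thesis
    by (simp del: transpose_matrix_vector flip: matrix_vector_mul_assoc)
qed

text \<open>The difference kills the dominant eigenvectors and scales every other one by
  \<open>- d r\<close>, so the Eckart-Young bound is attained.\<close>

lemma truncation_error:
  "(frobenius_norm (Us ** Ls ** transpose Us - \<Sigma>))\<^sup>2 = (\<Sum>r\<in>-range h. (d r)\<^sup>2)"
proof -
  have "(frobenius_norm (Us ** Ls ** transpose Us - \<Sigma>))\<^sup>2
      = (\<Sum>r\<in>UNIV. if r \<in> -range h then (d r)\<^sup>2 else 0)"
    unfolding frobenius_norm_squared_orthogonal[OF orth] matrix_vector_mult_diff_rdistrib
      truncation_eigenvector eig
    by (intro sum.cong) (auto simp: norm_column_orthogonal[OF orth])
  then show ?thesis
    by (simp add: sum.If_cases Compl_eq)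
qed

text \<open>The product has the left factor \<open>J ** P\<close>, which has only
  \<open>CARD('s)\<close> columns.\<close>

lemma rank_subspace_cov: "rank (subspace_cov J \<Psi> P) \<le> card (range h)"
  for P :: "real^'s^'p"
proof -
  have "rank (subspace_cov J \<Psi> P) \<le> rank (J ** P)"
    unfolding subspace_cov_def by (metis matrix_mul_assoc rank_mul_le_left)
  also have "\<dots> \<le> CARD('s)"
    using rank_bound[of "J ** P"] by simp
  finally show ?thesis
    using inj by (simp add: card_image)
qed

lemma subspace_cov_error_ge:
  "(\<Sum>r\<in>-range h. (d r)\<^sup>2) \<le> (frobenius_norm (subspace_cov J \<Psi> P - \<Sigma>))\<^sup>2"
  for P :: "real^'s^'p"
  by (rule eckart_young_le[OF orth eig rank_subspace_cov c_nonneg c_le le_c])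

lemma optimal_if_truncation:
  fixes P :: "real^'s^'p"
  assumes "rank P = CARD('s)" and "subspace_cov J \<Psi> P = Us ** Ls ** transpose Us"
  shows "is_optimal_subspace J \<Psi> P"
proof -
  have "frobenius_norm (subspace_cov J \<Psi> P - \<Sigma>) \<le> frobenius_norm (subspace_cov J \<Psi> P' - \<Sigma>)"
    for P' :: "real^'s^'p"
    unfolding assms(2) using subspace_cov_error_ge[of P', folded truncation_error]
    by (rule power2_le_imp_le) (rule frobenius_norm_nonneg)
  then have "\<not> frobenius_norm (subspace_cov J \<Psi> P' - \<Sigma>) < frobenius_norm (subspace_cov J \<Psi> P - \<Sigma>)"
    for P' :: "real^'s^'p"
    by (simp only: not_less)
  then show ?thesis
    using assms(1) unfolding is_optimal_subspace_def is_arg_min_def by blast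
qed

lemma truncation_if_error_le:
  fixes P :: "real^'s^'p"
  assumes "\<And>r. r \<in> range h \<Longrightarrow> c < d r"
    and "(frobenius_norm (subspace_cov J \<Psi> P - \<Sigma>))\<^sup>2 \<le> (\<Sum>r\<in>-range h. (d r)\<^sup>2)"
  shows "subspace_cov J \<Psi> P = Us ** Ls ** transpose Us"
  using orth
proof (rule matrix_eq_on_orthogonal_columns)
  show "subspace_cov J \<Psi> P *v column r U = Us ** Ls ** transpose Us *v column r U" for r
    unfolding truncation_eigenvector
    by (rule eckart_young_unique[OF orth eig rank_subspace_cov c_nonneg c_le le_c assms])
qed

text \<open>If a dominant eigenvalue vanished, all the eigenvalues outside the range of \<open>h\<close> would vanish too,
  leaving fewer than \<open>s\<close> nonzero ones.\<close>

lemma dominant_eigenvalue_pos: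
  assumes "CARD('s) \<le> rank J"
  shows "0 < d (h j)"
proof (rule ccontr)
  assume "\<not> 0 < d (h j)"
  with c_nonneg c_le[of "h j"] have "d (h j) = 0" "c = 0"
    by auto
  with le_c have "{r. d r \<noteq> 0} \<subseteq> h ` (UNIV - {j})"
    by force
  then have "card {r. d r \<noteq> 0} \<le> card (h ` (UNIV - {j}))"
    by (rule card_mono[rotated]) simp
  also have "\<dots> \<le> card (UNIV - {j})"
    by (rule card_image_le) simp
  also have "\<dots> < CARD('s)"
    by (rule psubset_card_mono) auto
  finally show False
    using rank_le_card_nonzero_eigenvalues[OF pos_def_matrix_inv[OF pos] orth eig] assms by simp
qed

section \<open>Optimal subspaces and their uniqueness\<close>

lemma Ls_inverse:
  assumes "CARD('s) \<le> rank J"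
  shows "Ls ** Li = mat 1" and "Li ** Ls = mat 1"
proof -
  have "d (h j) * inverse (d (h j)) = 1" "inverse (d (h j)) * d (h j) = 1" for j
    using dominant_eigenvalue_pos[OF assms, of j] by auto
  then show "Ls ** Li = mat 1" "Li ** Ls = mat 1"
    by (auto simp: Ls_def Li_def diag_mult mat_def vec_eq_iff)
qed

lemma transpose_Ls: "transpose Ls = Ls" and transpose_Li: "transpose Li = Li"
  by (auto simp: Ls_def Li_def transpose_def vec_eq_iff)

lemma transpose_W_A: "transpose W ** A = transpose Us ** J"
  by (simp add: W_def matrix_transpose_mul transpose_Psi matrix_inv_left pos pos_def_invertible
      flip: matrix_mul_assoc)

lemma J_W: "J ** W = Us ** Ls"
  using Sigma_Us by (simp add: W_def predictive_cov_def matrix_mul_assoc)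

lemma W_gram: "transpose W ** A ** W = Ls"
  by (simp add: transpose_W_A J_W Us_gram matrix_mul_assoc_subst[OF Us_gram] flip: matrix_mul_assoc)

lemma optimal_subspace:
  fixes Q :: "real^'s^'s"
  assumes "CARD('s) \<le> rank J" and "invertible Q"
  shows "rank (W ** Q) = CARD('s)" and "is_optimal_subspace J \<Psi> (W ** Q)"
    and "subspace_cov J \<Psi> (W ** Q) = Us ** Ls ** transpose Us"
proof -
  note Ls_inverse = Ls_inverse[OF assms(1)]
  define R where "R = matrix_inv Q"
  have QR: "Q ** R = mat 1" "transpose R ** transpose Q = mat 1" "transpose Q ** transpose R = mat 1"
    using assms(2) by (simp_all add: R_def matrix_inv_right matrix_inv_left flip: matrix_transpose_mul)
  define M where "M = transpose (W ** Q) ** A ** (W ** Q)"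
  have M: "M = transpose Q ** (Ls ** Q)"
    using W_gram by (simp add: M_def matrix_transpose_mul flip: matrix_mul_assoc)
      (simp add: matrix_mul_assoc)
  \<comment> \<open>The inverse of \<open>transpose Q ** Ls ** Q\<close>, factor by factor in
    reverse order.\<close>
  have inv: "M ** (R ** (Li ** transpose R)) = mat 1"
    by (simp add: M QR matrix_mul_assoc_subst[OF QR(1)] matrix_mul_assoc_subst[OF Ls_inverse(1)]
        flip: matrix_mul_assoc)
  \<comment> \<open>\<open>M\<close> is invertible and has the right factor \<open>W ** Q\<close>,
    which therefore has rank at least \<open>CARD('s)\<close>.\<close>
  then have "rank M = CARD('s)"
    by (metis antisym rank_I rank_bound min.bounded_iff rank_mul_le_left)
  moreover have "rank M \<le> rank (W ** Q)"
    unfolding M_def by (rule rank_mul_le_right)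
  moreover have "rank (W ** Q) \<le> CARD('s)"
    using rank_bound[of "W ** Q"] by simp
  ultimately show rank: "rank (W ** Q) = CARD('s)"
    by simp
  have JW: "transpose W ** transpose J = Ls ** transpose Us"
    by (metis J_W matrix_transpose_mul transpose_Ls)
  have "subspace_cov J \<Psi> (W ** Q) = J ** (W ** Q) ** (R ** (Li ** transpose R)) ** transpose (W ** Q) ** transpose J"
    using matrix_inv_eqI[OF inv] by (simp add: subspace_cov_def inv_Psi M_def)
  also have "\<dots> = Us ** Ls ** transpose Us"
    by (simp add: matrix_transpose_mul JW matrix_mul_assoc_subst[OF J_W]
        matrix_mul_assoc_subst[OF QR(1)] matrix_mul_assoc_subst[OF QR(2)]
        matrix_mul_assoc_subst[OF Ls_inverse(1)] flip: matrix_mul_assoc)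
  finally show cov: "subspace_cov J \<Psi> (W ** Q) = Us ** Ls ** transpose Us" .
  show "is_optimal_subspace J \<Psi> (W ** Q)"
    using rank cov by (rule optimal_if_truncation)
qed

lemma optimal_subspace_unique:
  fixes P :: "real^'s^'p"
  assumes rank_J: "CARD('s) \<le> rank J" and strict: "\<And>r. r \<in> range h \<Longrightarrow> c < d r"
    and opt: "is_optimal_subspace J \<Psi> P"
  shows "\<exists>Q. invertible Q \<and> P = W ** Q"
proof -
  note Ls_inverse = Ls_inverse[OF rank_J]
  have id: "invertible (mat 1 :: real^'s^'s)"
    unfolding invertible_def by (intro exI[of _ "mat 1"]) simp
  have rank_P: "rank P = CARD('s)"
    using opt by (simp add: is_optimal_subspace_def is_arg_min_def)
  \<comment> \<open>The choice \<open>Q = mat 1\<close> supplies a feasible competitor whose error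
    is that of the truncation.\<close>
  have "frobenius_norm (subspace_cov J \<Psi> P - \<Sigma>)
      \<le> frobenius_norm (subspace_cov J \<Psi> (W ** mat 1) - \<Sigma>)"
    using opt optimal_subspace(1)[OF rank_J id]
    by (auto simp: is_optimal_subspace_def is_arg_min_def not_less)
  then have "(frobenius_norm (subspace_cov J \<Psi> P - \<Sigma>))\<^sup>2 \<le> (\<Sum>r\<in>-range h. (d r)\<^sup>2)"
    unfolding optimal_subspace(3)[OF rank_J id] truncation_error[symmetric]
    by (rule power_mono) (rule frobenius_norm_nonneg)
  from truncation_if_error_le[OF strict this]
  have cov: "subspace_cov J \<Psi> P = Us ** Ls ** transpose Us" .
  define M where "M = transpose P ** A ** P"
  have inv_M: "invertible M"
    unfolding M_def by (intro pos_def_invertible pos_def_congruence pos rank_P)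
  define K where "K = transpose Us ** J ** P"
  have "K ** matrix_inv M ** transpose K = transpose Us ** subspace_cov J \<Psi> P ** Us"
    by (simp add: K_def subspace_cov_def inv_Psi M_def matrix_transpose_mul matrix_mul_assoc)
  also have "\<dots> = Ls"
    by (simp add: cov Us_gram matrix_mul_assoc_subst[OF Us_gram] flip: matrix_mul_assoc)
  finally have KMK: "K ** matrix_inv M ** transpose K = Ls" .
  \<comment> \<open>Multiplying by \<open>Li\<close> exhibits a right inverse of the square matrix
    \<open>K\<close>, which is then two-sided; this allows solving for \<open>M\<close>
    below.\<close>
  have KI: "K ** (matrix_inv M ** transpose K ** Li) = mat 1"
    by (metis KMK Ls_inverse(1) matrix_mul_assoc)
  then have K_inv: "(matrix_inv M ** transpose K ** Li) ** K = mat 1"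
    using matrix_left_right_inverse by blast
  with KI have inv_K: "invertible K"
    unfolding invertible_def by blast
  have "M = M ** ((matrix_inv M ** transpose K ** Li) ** K)"
    by (simp add: K_inv)
  also have "\<dots> = transpose K ** Li ** K"
    by (simp add: matrix_mul_assoc matrix_inv_right[OF inv_M])
  finally have M: "M = transpose K ** Li ** K" .
  \<comment> \<open>Since \<open>transpose W ** A ** P = K\<close> and \<open>W\<close> has Gram
    matrix \<open>Ls\<close>, the matrix \<open>W ** Q\<close> is the projection of \<open>P\<close>
    onto the range of \<open>W\<close>, orthogonal with respect to \<open>A\<close>.\<close>
  define Q where "Q = Li ** K"
  have inv_Q: "invertible Q"
    unfolding Q_def using Ls_inverse inv_K by (intro invertible_mult) (auto simp: invertible_def)
  have QQ: "transpose (W ** Q) ** A ** (W ** Q) = M"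
    using W_gram unfolding M Q_def
    by (simp add: matrix_transpose_mul transpose_Li Ls_inverse(1) matrix_mul_assoc_subst[OF Ls_inverse(1)]
        matrix_mul_assoc_subst[OF Ls_inverse(2)] matrix_mul_assoc_subst[OF transpose_W_A]
        J_W matrix_mul_assoc_subst[OF J_W] matrix_mul_assoc_subst[OF Us_gram] flip: matrix_mul_assoc)
  have QP: "transpose (W ** Q) ** A ** P = M"
    unfolding M Q_def
    by (simp add: matrix_transpose_mul transpose_Li K_def matrix_mul_assoc_subst[OF transpose_W_A]
        flip: matrix_mul_assoc)
  have "transpose P ** A ** (W ** Q) = transpose (transpose (W ** Q) ** A ** P)"
    by (simp add: matrix_transpose_mul sym matrix_mul_assoc)
  also have "\<dots> = M"
    unfolding QP M by (simp add: matrix_transpose_mul transpose_Li matrix_mul_assoc)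
  finally have PQ: "transpose P ** A ** (W ** Q) = M" .
  \<comment> \<open>Expanding gives four products, each equal to \<open>M\<close>, two of them with
    a minus sign.\<close>
  have "transpose (P - W ** Q) ** A ** (P - W ** Q) = 0"
    using QQ QP PQ M_def
    by (simp add: transpose_diff matrix_diff_ldistrib matrix_diff_rdistrib)
  then have "P - W ** Q = 0"
    by (rule pos_def_congruence_eq_0[OF pos])
  with inv_Q show ?thesis
    by auto
qed

end

section \<open>The Laplace posterior: passing from numbered eigenvalues to the abstract
  setting\<close>

theorem theorem1:
  fixes f :: "real^'p \<Rightarrow> 'x \<Rightarrow> real^'c"
    and \<theta> :: "real^'p"
    and x :: "'n::finite \<Rightarrow> 'x"
    and N :: nat and xt :: "nat \<Rightarrow> 'x" and yt :: "nat \<Rightarrow> 'y"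
    and nll :: "'y \<Rightarrow> real^'c \<Rightarrow> real"
    and H :: "nat \<Rightarrow> real^'c^'c"
    and \<tau> :: real
    and J :: "real^'p^('n \<times> 'c)"
    and \<Psi> :: "real^'p^'p"
    and U :: "real^('n \<times> 'c)^('n \<times> 'c)"
    and \<sigma> :: "nat \<Rightarrow> real"
    and \<nu> :: "'n \<times> 'c \<Rightarrow> nat"
    and \<kappa> :: "'s::finite \<Rightarrow> nat"
    and Us :: "real^'s^('n \<times> 'c)"
    and Ls :: "real^'s^'s"
  assumes diff: "\<And>z. (\<lambda>t. f t z) differentiable (at \<theta>)"
    and hess: "\<And>i. i \<in> {1..N} \<Longrightarrow> has_hessian (nll (yt i)) (H i) (f \<theta> (xt i))"
    and hess_sym: "\<And>i. i \<in> {1..N} \<Longrightarrow> symmetric_matrix (H i)"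
    and hess_psd: "\<And>i. i \<in> {1..N} \<Longrightarrow> pos_semidef (H i)"
    and prior: "\<tau> > 0"
    and J: "J = concat_jacobian f \<theta> x"
    and Psi: "\<Psi> = laplace_covariance f \<theta> N xt H \<tau>"
    and nu: "numbering \<nu>"
    and kappa: "numbering \<kappa>"
    and orth: "orthogonal_matrix U"
    and eig: "predictive_cov J \<Psi> = U ** diag_matrix \<nu> \<sigma> ** transpose U"
    and sorted: "\<And>i j. 1 \<le> i \<Longrightarrow> i \<le> j \<Longrightarrow> j \<le> CARD('n) * CARD('c) \<Longrightarrow> \<sigma> j \<le> \<sigma> i"
    and nonneg: "\<And>i. 1 \<le> i \<Longrightarrow> i \<le> CARD('n) * CARD('c) \<Longrightarrow> 0 \<le> \<sigma> i"
    and convention: "\<sigma> (CARD('n) * CARD('c) + 1) = 0"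
    and s_le: "CARD('s) \<le> min (CARD('n) * CARD('c)) CARD('p)"
    and Us: "Us = first_columns \<nu> \<kappa> U"
    and Ls: "Ls = diag_matrix \<kappa> \<sigma>"
    and full_rank: "rank J = min (CARD('n) * CARD('c)) CARD('p)"
  shows "(\<forall>Q :: real^'s^'s. invertible Q \<longrightarrow>
            rank (\<Psi> ** transpose J ** Us ** Q) = CARD('s) \<and>
            is_optimal_subspace J \<Psi> (\<Psi> ** transpose J ** Us ** Q) \<and>
            subspace_cov J \<Psi> (\<Psi> ** transpose J ** Us ** Q) = Us ** Ls ** transpose Us)
       \<and> (\<sigma> (CARD('s)) > \<sigma> (CARD('s) + 1) \<longrightarrow>
            (\<forall>P :: real^'s^'p. is_optimal_subspace J \<Psi> P \<longrightarrow>
               (\<exists>Q :: real^'s^'s. invertible Q \<and> P = \<Psi> ** transpose J ** Us ** Q)))"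
proof -
  define A where "A = ggn_precision f \<theta> N xt H \<tau>"
  define d where "d = (\<lambda>r. \<sigma> (\<nu> r))"
  define h where "h = (\<lambda>j. inv \<nu> (\<kappa> j))"
  \<comment> \<open>The first discarded eigenvalue is the threshold; for
    \<open>CARD('s) = CARD('n) * CARD('c)\<close> it is 0 by the convention.\<close>
  define c where "c = \<sigma> (CARD('s) + 1)"
  have \<nu>: "bij_betw \<nu> UNIV {1..CARD('n) * CARD('c)}" and \<kappa>: "bij_betw \<kappa> UNIV {1..CARD('s)}"
    using nu kappa by (simp_all add: numbering_def)
  have \<nu>_range: "1 \<le> \<nu> r \<and> \<nu> r \<le> CARD('n) * CARD('c)" for r
    using bij_betw_apply[OF \<nu>, of r] by simp
  have \<kappa>_range: "1 \<le> \<kappa> j \<and> \<kappa> j \<le> CARD('s)" for j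
    using bij_betw_apply[OF \<kappa>, of j] by simp
  \<comment> \<open>\<open>\<kappa> j\<close> is at most \<open>CARD('s)\<close>, hence lies in the
    range of \<open>\<nu>\<close>, so \<open>inv \<nu>\<close> is a genuine preimage there.\<close>
  have \<nu>_h: "\<nu> (h j) = \<kappa> j" for j
    unfolding h_def using \<nu> \<kappa>_range[of j] s_le
    by (intro f_inv_into_f) (auto simp: bij_betw_def)
  have range_h: "r \<in> range h \<longleftrightarrow> \<nu> r \<le> CARD('s)" for r
  proof
    assume "\<nu> r \<le> CARD('s)"
    then have "\<nu> r \<in> range \<kappa>"
      using \<kappa> \<nu>_range[of r] by (simp add: bij_betw_def)
    then obtain j where "\<nu> r = \<nu> (h j)"
      unfolding \<nu>_h by auto
    then show "r \<in> range h"
      using \<nu> by (auto simp: bij_betw_def inj_eq)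
  qed (use \<nu>_h \<kappa>_range in auto)
  \<comment> \<open>When nothing is discarded the ordering says nothing about index
    \<open>CARD('s) + 1\<close>; the convention and nonnegativity take over.\<close>
  have \<sigma>_next: "\<sigma> (CARD('s) + 1) \<le> \<sigma> k" if "1 \<le> k" "k \<le> CARD('s)" for k
    using that sorted[of k "CARD('s) + 1"] nonneg[of k] convention s_le
    by (cases "CARD('s) = CARD('n) * CARD('c)") auto
  have \<sigma>_ge: "0 \<le> \<sigma> k \<and> \<sigma> k \<le> \<sigma> (CARD('s) + 1)"
    if "CARD('s) < k" "k \<le> CARD('n) * CARD('c)" for k
    using that sorted[of "CARD('s) + 1" k] nonneg[of k] by auto
  interpret E: dominant_eigenvectors J A U d h c
  proof
    show "pos_def A"
      unfolding A_def using hess_psd prior by (rule ggn_precision_pos_def)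
    show "transpose A = A"
      unfolding A_def using hess_sym by (rule ggn_precision_symmetric)
    show "orthogonal_matrix U"
      by (rule orth)
    show "inj h"
      using \<nu>_h \<kappa> by (metis bij_betw_def injD injI)
    show "predictive_cov J (matrix_inv A) *v column r U = d r *\<^sub>R column r U" for r
    proof -
      \<comment> \<open>Column \<open>r\<close> is \<open>U *v axis r 1\<close>, so the eigenvector
        equation reduces to the action of the diagonal factor on a basis vector.\<close>
      have "transpose U *v (U *v axis r 1) = axis r 1"
        using orth by (simp add: orthogonal_matrix matrix_vector_mul_assoc del: transpose_matrix_vector)
      moreover have "diag_matrix \<nu> \<sigma> *v axis r 1 = d r *\<^sub>R axis r 1"
        unfolding matrix_vector_mult_basis
        by (auto simp: diag_matrix_def column_def vec_eq_iff axis_def d_def)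
      ultimately show ?thesis
        using eig
        by (simp add: Psi laplace_covariance_def A_def matrix_vector_mult_scaleR
            del: transpose_matrix_vector flip: matrix_vector_mult_basis matrix_vector_mul_assoc)
    qed
    show "0 \<le> c"
      using convention s_le nonneg[of "CARD('s) + 1"]
      by (cases "CARD('s) = CARD('n) * CARD('c)") (auto simp: c_def)
    show "c \<le> d r" if "r \<in> range h" for r
      using that \<nu>_range[of r] \<sigma>_next[of "\<nu> r"] by (simp add: range_h c_def d_def)
    show "0 \<le> d r \<and> d r \<le> c" if "r \<notin> range h" for r
      using that \<nu>_range[of r] \<sigma>_ge[of "\<nu> r"] by (simp add: range_h c_def d_def)
  qed
  have \<Psi>: "matrix_inv A = \<Psi>"
    by (simp add: Psi laplace_covariance_def A_def)
  have E_Us: "E.Us = Us"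
    unfolding E.Us_def by (simp add: Us first_columns_def h_def)
  have E_Ls: "E.Ls = Ls"
    unfolding E.Ls_def by (auto simp: Ls diag_matrix_def d_def \<nu>_h vec_eq_iff)
  have E_W: "E.W = \<Psi> ** transpose J ** Us"
    by (simp add: E.W_def \<Psi> E_Us)
  have rank_J: "CARD('s) \<le> rank J"
    using s_le full_rank by simp
  \<comment> \<open>By the ordering, the smallest selected eigenvalue is the one numbered
    \<open>CARD('s)\<close>, so the gap there separates all selected ones from
    \<open>c\<close>.\<close>
  have strict: "c < d r" if "\<sigma> (CARD('s) + 1) < \<sigma> (CARD('s))" "r \<in> range h" for r
  proof -
    have "\<sigma> (CARD('s)) \<le> d r"
      using that(2) sorted[of "\<nu> r" "CARD('s)"] \<nu>_range[of r] s_le by (simp add: range_h d_def)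
    then show ?thesis
      using that(1) by (simp add: c_def)
  qed
  show ?thesis
    using E.optimal_subspace[OF rank_J] E.optimal_subspace_unique[OF rank_J strict]
    unfolding \<Psi> E_Us E_Ls E_W by blast
qed

end
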